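(* For the two-dimensional Euler equations, define (for all pairs of states with $\rho,p>0$, and with $RT=p/\rho$, $s=\log RT-(\gamma-1)\log\rho$) $$f^{x}_{\rho}=\{\{\rho\}\}_{\log}\{\{v_x\}\},\quad f^x_{\rho v_x}=\{\{v_x\}\}f^x_\rho+\{\{p\}\},\quad f^x_{\rho v_y}=\{\{v_y\}\}f^x_\rho,$$ $$f^x_{\rho s}=\left(\frac{\{\{RT\}\}}{\{\{RT\}\}_{\log}}-\gamma+\{\{\log RT\}\}-(\gamma-1)\{\{\log\rho\}\}\right)f^x_\rho+(\gamma-1)\{\{\rho\}\}\{\{v_x\}\},$$ $$f^x_{\rho e}=\left(-\frac{\{\{v_x^2\}\}+\{\{v_y^2\}\}}{2}+\frac{\gamma}{\gamma-1}\{\{RT\}\}-\frac{1}{\gamma-1}\{\{sRT\}\}\right)f^x_\rho+\{\{v_x\}\}f^x_{\rho v_x}+\{\{v_y\}\}f^x_{\rho v_y}+\frac{1}{\gamma-1}\{\{RT\}\}f^x_{\rho s}-\{\{\rho RTv_x\}\},$$ and $$f^{y}_{\rho}=\{\{\rho\}\}_{\log}\{\{v_y\}\},\quad f^y_{\rho v_x}=\{\{v_x\}\}f^y_\rho,\quad f^y_{\rho v_y}=\{\{v_y\}\}f^y_\rho+\{\{p\}\},$$ $$f^y_{\rho s}=\left(\frac{\{\{RT\}\}}{\{\{RT\}\}_{\log}}-\gamma+\{\{\log RT\}\}-(\gamma-1)\{\{\log\rho\}\}\right)f^y_\rho+(\gamma-1)\{\{\rho\}\}\{\{v_y\}\},$$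 $$f^y_{\rho e}=\left(-\frac{\{\{v_x^2\}\}+\{\{v_y^2\}\}}{2}+\frac{\gamma}{\gamma-1}\{\{RT\}\}-\frac{1}{\gamma-1}\{\{sRT\}\}\right)f^y_\rho+\{\{v_x\}\}f^y_{\rho v_x}+\{\{v_y\}\}f^y_{\rho v_y}+\frac{1}{\gamma-1}\{\{RT\}\}f^y_{\rho s}-\{\{\rho RTv_y\}\}.$$ Then the fluxes $f^j=(f^j_\rho,f^j_{\rho v_x},f^j_{\rho v_y},f^j_{\rho e})^T$, $j\in\{x,y\}$, are consistent, entropy conservative, and kinetic energy preserving numerical fluxes for the Euler equations.
   Context: Euler equations: $\partial_tu+\partial_xf_x(u)+\partial_yf_y(u)=0$, $u=(\rho,\rho v_x,\rho v_y,\rho e)^T$, $f_x=(\rho v_x,\rho v_x^2+p,\rho v_xv_y,(\rho e+p)v_x)^T$, $f_y=(\rho v_y,\rho v_xv_y,\rho v_y^2+p,(\rho e+p)v_y)^T$, $p=(\gamma-1)(\rho e-\frac12\rho v^2)$, $v^2=v_x^2+v_y^2$, $\gamma>1$ constant, $\rho,p>0$. With $s=\log(p/\rho^\gamma)$, the entropy is $U=-\rho s/(\gamma-1)$, the entropy variables are $w=\left(\frac{\gamma}{\gamma-1}-\frac{s}{\gamma-1}-\frac{\rho v^2}{2p},\frac{\rho v_x}{p},\frac{\rho v_y}{p},-\frac{\rho}{p}\right)^T$ and the flux potentials are $\psi_x=\rho v_x$, $\psi_y=\rho v_y$. Means of a quantity $a$ with values $a_-,a_+$ at the states $u_-,u_+$: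 $\{\{a\}\}=\frac{a_-+a_+}2$; for $a_\pm>0$, $\{\{a\}\}_{\log}=\frac{a_+-a_-}{\log a_+-\log a_-}$ (and $=a$ if $a_-=a_+=a$). A two-point flux $f^j(u_-,u_+)$, $j\in\{x,y\}$, is consistent if $f^j(u,u)=f_j(u)$; entropy conservative if $(w_+-w_-)\cdot f^j(u_-,u_+)-(\psi_{j,+}-\psi_{j,-})=0$ for all pairs of states; kinetic energy preserving if $f^j_{\rho v_j}=\{\{v_j\}\}f^j_\rho+p^{\mathrm{num}}$ with $p^{\mathrm{num}}$ a consistent approximation of the pressure, i.e. $p^{\mathrm{num}}(u,u)=p$ (here $p^{\mathrm{num}}=\{\{p\}\}=\{\{\rho RT\}\}$). Background for the auxiliary quantity $f^j_{\rho s}$: it is the $\rho s$-component of a numerical flux for the system in the variables $(\rho,\rho v_x,\rho v_y,\rho s)$ in which the roles of energy and entropy are exchanged; $f^j_{\rho e}$ is the corresponding numerical energy flux. *)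

theory Defs
  imports "HOL-Analysis.Analysis"
begin

text \<open>
  States are vectors of conserved variables (density, x-momentum, y-momentum, total energy),
  that is \<open>(\<rho>, \<rho> v_x, \<rho> v_y, \<rho> e)\<close>, with components 1, 2, 3, 4. Every other quantity is a function
  of the state.
\<close>

type_synonym state = "real ^ 4"

datatype direction = X | Y

text \<open>Component of the state vector holding the momentum in a given direction.\<close>

fun mom_index :: "direction \<Rightarrow> 4" where
  "mom_index X = 2"
| "mom_index Y = 3"

definition density :: "state \<Rightarrow> real" where
  "density u = u $ 1"

definition velocity :: "direction \<Rightarrow> state \<Rightarrow> real" where
  "velocity j u = u $ mom_index j / u $ 1"

definition speed_sq :: "state \<Rightarrow> real" where
  "speed_sq u = (velocity X u)\<^sup>2 + (velocity Y u)\<^sup>2"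

definition energy :: "state \<Rightarrow> real" where
  "energy u = u $ 4"

definition pressure :: "real \<Rightarrow> state \<Rightarrow> real" where
  "pressure \<gamma> u = (\<gamma> - 1) * (energy u - density u * speed_sq u / 2)"

definition admissible :: "real \<Rightarrow> state set" where
  "admissible \<gamma> = {u. density u > 0 \<and> pressure \<gamma> u > 0}"

fun euler_flux :: "real \<Rightarrow> direction \<Rightarrow> state \<Rightarrow> state" where
  "euler_flux \<gamma> X u = vector
     [density u * velocity X u,
      density u * (velocity X u)\<^sup>2 + pressure \<gamma> u,
      density u * velocity X u * velocity Y u,
      (energy u + pressure \<gamma> u) * velocity X u]"
| "euler_flux \<gamma> Y u = vector
     [density u * velocity Y u,
      density u * velocity X u * velocity Y u,
      density u * (velocity Y u)\<^sup>2 + pressure \<gamma> u,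
      (energy u + pressure \<gamma> u) * velocity Y u]"

definition specific_entropy :: "real \<Rightarrow> state \<Rightarrow> real" where
  "specific_entropy \<gamma> u = ln (pressure \<gamma> u / density u powr \<gamma>)"

text \<open>
  Entropy variables and flux potentials belonging to the entropy \<open>U = - \<rho> s / (\<gamma> - 1)\<close>.
\<close>

definition entropy_vars :: "real \<Rightarrow> state \<Rightarrow> real ^ 4" where
  "entropy_vars \<gamma> u = vector
     [\<gamma> / (\<gamma> - 1) - specific_entropy \<gamma> u / (\<gamma> - 1) - density u * speed_sq u / (2 * pressure \<gamma> u),
      density u * velocity X u / pressure \<gamma> u,
      density u * velocity Y u / pressure \<gamma> u,
      - density u / pressure \<gamma> u]"

definition flux_potential :: "direction \<Rightarrow> state \<Rightarrow> real" where
  "flux_potential j u = density u * velocity j u"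

definition mean :: "(state \<Rightarrow> real) \<Rightarrow> state \<Rightarrow> state \<Rightarrow> real" where
  "mean a um up = (a um + a up) / 2"

definition log_mean :: "(state \<Rightarrow> real) \<Rightarrow> state \<Rightarrow> state \<Rightarrow> real" where
  "log_mean a um up =
     (if a um = a up then a um else (a up - a um) / (ln (a up) - ln (a um)))"

type_synonym two_point_flux = "state \<Rightarrow> state \<Rightarrow> real ^ 4"

definition consistent_flux :: "real \<Rightarrow> direction \<Rightarrow> two_point_flux \<Rightarrow> bool" where
  "consistent_flux \<gamma> j f \<longleftrightarrow> (\<forall>u \<in> admissible \<gamma>. f u u = euler_flux \<gamma> j u)"

definition entropy_conservative :: "real \<Rightarrow> direction \<Rightarrow> two_point_flux \<Rightarrow> bool" where
  "entropy_conservative \<gamma> j f \<longleftrightarrow>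
     (\<forall>um \<in> admissible \<gamma>. \<forall>up \<in> admissible \<gamma>.
        (entropy_vars \<gamma> up - entropy_vars \<gamma> um) \<bullet> f um up
          - (flux_potential j up - flux_potential j um) = 0)"

definition kinetic_energy_preserving ::
    "real \<Rightarrow> direction \<Rightarrow> (state \<Rightarrow> state \<Rightarrow> real) \<Rightarrow> two_point_flux \<Rightarrow> bool" where
  "kinetic_energy_preserving \<gamma> j p_num f \<longleftrightarrow>
     (\<forall>u \<in> admissible \<gamma>. p_num u u = pressure \<gamma> u) \<and>
     (\<forall>um \<in> admissible \<gamma>. \<forall>up \<in> admissible \<gamma>.
        f um up $ mom_index j = mean (velocity j) um up * f um up $ 1 + p_num um up)"

definition RT :: "real \<Rightarrow> state \<Rightarrow> real" where
  "RT \<gamma> u = pressure \<gamma> u / density u"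

text \<open>
  The specific entropy as it enters the numerical flux; on admissible states it agrees with
  \<^const>\<open>specific_entropy\<close>.
\<close>

definition entropy_RT :: "real \<Rightarrow> state \<Rightarrow> real" where
  "entropy_RT \<gamma> u = ln (RT \<gamma> u) - (\<gamma> - 1) * ln (density u)"

definition num_mass :: "direction \<Rightarrow> state \<Rightarrow> state \<Rightarrow> real" where
  "num_mass j um up = log_mean density um up * mean (velocity j) um up"

text \<open>Component \<open>k\<close> of the numerical momentum flux in direction \<open>j\<close>.\<close>

definition num_momentum :: "real \<Rightarrow> direction \<Rightarrow> direction \<Rightarrow> state \<Rightarrow> state \<Rightarrow> real" where
  "num_momentum \<gamma> j k um up =
     mean (velocity k) um up * num_mass j um up + (if k = j then mean (pressure \<gamma>) um up else 0)"

definition num_entropy :: "real \<Rightarrow> direction \<Rightarrow> state \<Rightarrow> state \<Rightarrow> real" where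
  "num_entropy \<gamma> j um up =
     (mean (RT \<gamma>) um up / log_mean (RT \<gamma>) um up - \<gamma>
        + mean (\<lambda>u. ln (RT \<gamma> u)) um up - (\<gamma> - 1) * mean (\<lambda>u. ln (density u)) um up)
       * num_mass j um up
     + (\<gamma> - 1) * mean density um up * mean (velocity j) um up"

definition num_energy :: "real \<Rightarrow> direction \<Rightarrow> state \<Rightarrow> state \<Rightarrow> real" where
  "num_energy \<gamma> j um up =
     (- (mean (\<lambda>u. (velocity X u)\<^sup>2) um up + mean (\<lambda>u. (velocity Y u)\<^sup>2) um up) / 2
        + \<gamma> / (\<gamma> - 1) * mean (RT \<gamma>) um up
        - 1 / (\<gamma> - 1) * mean (\<lambda>u. entropy_RT \<gamma> u * RT \<gamma> u) um up)
       * num_mass j um up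
     + mean (velocity X) um up * num_momentum \<gamma> j X um up
     + mean (velocity Y) um up * num_momentum \<gamma> j Y um up
     + 1 / (\<gamma> - 1) * mean (RT \<gamma>) um up * num_entropy \<gamma> j um up
     - mean (\<lambda>u. density u * RT \<gamma> u * velocity j u) um up"

definition num_flux :: "real \<Rightarrow> direction \<Rightarrow> two_point_flux" where
  "num_flux \<gamma> j um up = vector
     [num_mass j um up, num_momentum \<gamma> j X um up, num_momentum \<gamma> j Y um up, num_energy \<gamma> j um up]"

end

theory Submission imports Defs begin

text \<open>
  Write \<open>\<Delta>a = a\<^sub>+ - a\<^sub>-\<close>. Entropy conservation is checked after multiplication by
  \<open>(\<gamma> - 1) T\<^sub>- T\<^sub>+\<close>, where \<open>T = RT\<close>. The kinetic terms cancel by the product rule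
  \<open>\<Delta>(a b) = {{a}} \<Delta>b + {{b}} \<Delta>a\<close>. The logarithmic means enter only through
  \<open>{{a}}\<^sub>l\<^sub>o\<^sub>g \<Delta>(log a) = \<Delta>a\<close>, for \<open>a = \<rho>\<close> and \<open>a = T\<close>, and what remains is a polynomial identity.
\<close>

lemma vector_4 [simp]:
  "(vector [a, b, c, d] :: ('a::zero) ^ 4) $ 1 = a"
  "(vector [a, b, c, d] :: ('a::zero) ^ 4) $ 2 = b"
  "(vector [a, b, c, d] :: ('a::zero) ^ 4) $ 3 = c"
  "(vector [a, b, c, d] :: ('a::zero) ^ 4) $ 4 = d"
  by (simp_all add: vector_def)

lemma inner_vector_4:
  fixes w :: "real ^ 4"
  shows "w \<bullet> vector [a, b, c, d] = w $ 1 * a + w $ 2 * b + w $ 3 * c + w $ 4 * d"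
  by (simp add: inner_vec_def sum_4)

lemma mean_same [simp]: "mean a u u = a u"
  by (simp add: mean_def)

lemma log_mean_same [simp]: "log_mean a u u = a u"
  by (simp add: log_mean_def)

text \<open>At equal values both sides vanish. Otherwise injectivity of \<open>ln\<close> on the
  positive reals makes the denominator nonzero.\<close>

lemma log_mean_mult_ln_diff:
  assumes "a um > 0" "a up > 0"
  shows "log_mean a um up * (ln (a up) - ln (a um)) = a up - a um"
  using assms by (auto simp: log_mean_def)

text \<open>Since \<open>ln\<close> is increasing, numerator and denominator have the same sign.
  This permits cancelling the log mean in \<open>K\<close> below.\<close>

lemma log_mean_pos:
  assumes "a um > 0" "a up > 0"
  shows "log_mean a um up > 0"
proof (cases "a um < a up")
  case True
  then show ?thesis
    using assms by (simp add: log_mean_def)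
next
  case False
  then show ?thesis
    using assms by (auto simp: log_mean_def divide_neg_neg)
qed

lemma admissible_density_pos: "u \<in> admissible \<gamma> \<Longrightarrow> density u > 0"
  by (simp add: admissible_def)

lemma admissible_pressure_pos: "u \<in> admissible \<gamma> \<Longrightarrow> pressure \<gamma> u > 0"
  by (simp add: admissible_def)

lemma admissible_RT_pos: "u \<in> admissible \<gamma> \<Longrightarrow> RT \<gamma> u > 0"
  by (simp add: admissible_def RT_def)

lemma pressure_eq_density_RT: "u \<in> admissible \<gamma> \<Longrightarrow> pressure \<gamma> u = density u * RT \<gamma> u"
  by (simp add: admissible_def RT_def)

text \<open>With p the pressure, both sides equal ln p - \<gamma> ln \<rho>.\<close>

lemma specific_entropy_eq_entropy_RT:
  assumes "u \<in> admissible \<gamma>"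
  shows "specific_entropy \<gamma> u = entropy_RT \<gamma> u"
  using admissible_density_pos[OF assms] admissible_pressure_pos[OF assms]
  by (simp add: specific_entropy_def entropy_RT_def RT_def ln_div ln_powr algebra_simps)

text \<open>Since \<rho>/p = 1 / \<open>RT\<close>, density survives only inside the
  entropy.\<close>

lemma entropy_vars_RT:
  assumes "u \<in> admissible \<gamma>"
  shows "entropy_vars \<gamma> u = vector
     [\<gamma> / (\<gamma> - 1) - entropy_RT \<gamma> u / (\<gamma> - 1) - speed_sq u / (2 * RT \<gamma> u),
      velocity X u / RT \<gamma> u, velocity Y u / RT \<gamma> u, - 1 / RT \<gamma> u]"
  using admissible_density_pos[OF assms]
  by (simp add: entropy_vars_def specific_entropy_eq_entropy_RT[OF assms] RT_def mult.commute)

lemma energy_eq: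
  assumes "\<gamma> \<noteq> 1"
  shows "energy u = pressure \<gamma> u / (\<gamma> - 1) + density u * speed_sq u / 2"
  using assms by (simp add: pressure_def)

lemma num_energy_same:
  assumes "\<gamma> > 1" and u: "u \<in> admissible \<gamma>"
  shows "num_energy \<gamma> j u u = (energy u + pressure \<gamma> u) * velocity j u"
proof -
  define r t v x y s where "r = density u" and "t = RT \<gamma> u" and "v = velocity j u"
    and "x = velocity X u" and "y = velocity Y u" and "s = entropy_RT \<gamma> u"
  \<comment> \<open>The pressure acts only on the momentum in direction \<open>j\<close>; its work
    \<open>v * (r * t)\<close> cancels the final subtracted mean in
    \<open>num_energy\<close>.\<close>
  have xy: "x * (if X = j then r * t else 0) + y * (if Y = j then r * t else 0) = v * (r * t)"
    by (cases j) (simp_all add: x_def y_def v_def)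
  \<comment> \<open>At equal states the quotient of the two means is 1, so the remaining (1 -
    \<gamma>) \<rho> v cancels against the last term (\<gamma> - 1) \<rho> v.\<close>
  have entropy: "num_entropy \<gamma> j u u = s * (r * v)"
    using admissible_RT_pos[OF u]
    by (simp add: num_entropy_def num_mass_def s_def r_def v_def entropy_RT_def)
      (simp add: algebra_simps)
  have "num_energy \<gamma> j u u =
      (- (x\<^sup>2 + y\<^sup>2) / 2 + \<gamma> / (\<gamma> - 1) * t - 1 / (\<gamma> - 1) * (s * t)) * (r * v)
        + x * (x * (r * v)) + y * (y * (r * v))
        + (x * (if X = j then r * t else 0) + y * (if Y = j then r * t else 0))
        + 1 / (\<gamma> - 1) * t * (s * (r * v)) - r * t * v"
    unfolding num_energy_def entropy num_momentum_def num_mass_def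
      mean_same log_mean_same pressure_eq_density_RT[OF u]
    by (simp only: r_def t_def v_def x_def y_def s_def) (simp add: algebra_simps)
  also have "\<dots> = (r * t / (\<gamma> - 1) + r * (x\<^sup>2 + y\<^sup>2) / 2 + r * t) * v"
    unfolding xy using assms(1) by (simp add: divide_simps power2_eq_square) (simp add: algebra_simps)
  also have "\<dots> = (energy u + pressure \<gamma> u) * velocity j u"
    using assms(1) energy_eq[of \<gamma> u]
    by (simp add: pressure_eq_density_RT[OF u] speed_sq_def r_def t_def x_def y_def v_def)
  finally show ?thesis .
qed

lemma num_flux_consistent:
  assumes "\<gamma> > 1"
  shows "consistent_flux \<gamma> j (num_flux \<gamma> j)"
  unfolding consistent_flux_def
proof
  fix u
  assume "u \<in> admissible \<gamma>"
  then show "num_flux \<gamma> j u u = euler_flux \<gamma> j u"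
    by (cases j) (simp_all add: num_flux_def num_energy_same[OF assms] num_momentum_def num_mass_def
        power2_eq_square mult_ac)
qed

text \<open>
  Here \<open>l\<close> and \<open>m\<close> stand for \<open>log T\<close> and \<open>log \<rho>\<close>, \<open>K\<close> for \<open>{{T}} / {{T}}\<^sub>l\<^sub>o\<^sub>g\<close>, and \<open>P\<close>, \<open>Q\<close> for
  the pressure contributions to the two momentum fluxes, one of which vanishes.
\<close>

lemma entropy_balance:
  fixes \<gamma> r1 r2 t1 t2 v1 v2 x1 x2 y1 y2 l1 l2 m1 m2 F K P Q :: real
  defines "s1 \<equiv> l1 - (\<gamma> - 1) * m1" and "s2 \<equiv> l2 - (\<gamma> - 1) * m2"
    and "M \<equiv> (x1 + x2) / 2 * F + P" and "N \<equiv> (y1 + y2) / 2 * F + Q"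
    and "S \<equiv> (K - \<gamma> + (l1 + l2) / 2 - (\<gamma> - 1) * ((m1 + m2) / 2)) * F
           + (\<gamma> - 1) * ((r1 + r2) / 2) * ((v1 + v2) / 2)"
  defines "E \<equiv> (- ((x1\<^sup>2 + x2\<^sup>2) / 2 + (y1\<^sup>2 + y2\<^sup>2) / 2) / 2 + \<gamma> / (\<gamma> - 1) * ((t1 + t2) / 2)
             - 1 / (\<gamma> - 1) * ((s1 * t1 + s2 * t2) / 2)) * F
           + (x1 + x2) / 2 * M + (y1 + y2) / 2 * N
           + 1 / (\<gamma> - 1) * ((t1 + t2) / 2) * S
           - (r1 * t1 * v1 + r2 * t2 * v2) / 2"
  assumes "\<gamma> \<noteq> 1" "t1 \<noteq> 0" "t2 \<noteq> 0"
    and F: "F * (m2 - m1) = (r2 - r1) * ((v1 + v2) / 2)"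
    and K: "K * (t2 - t1) = (t1 + t2) / 2 * (l2 - l1)"
    and P: "P * (x2 - x1) + Q * (y2 - y1) = (r1 * t1 + r2 * t2) / 2 * (v2 - v1)"
  shows "((\<gamma> / (\<gamma> - 1) - s2 / (\<gamma> - 1) - (x2\<^sup>2 + y2\<^sup>2) / (2 * t2))
            - (\<gamma> / (\<gamma> - 1) - s1 / (\<gamma> - 1) - (x1\<^sup>2 + y1\<^sup>2) / (2 * t1))) * F
         + (x2 / t2 - x1 / t1) * M + (y2 / t2 - y1 / t1) * N + (- 1 / t2 - - 1 / t1) * E
         - (r2 * v2 - r1 * v1) = 0" (is "?D = 0")
proof -
  define d where "d = \<gamma> - 1"
  define t where "t = (t1 + t2) / 2"
  have d: "d \<noteq> 0" and \<gamma>: "\<gamma> = d + 1"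
    using assms(7) by (simp_all add: d_def)
  have "d * t1 * t2 * ?D =
        (- (s2 - s1) * t1 * t2 - d * (x2\<^sup>2 + y2\<^sup>2) * t1 / 2 + d * (x1\<^sup>2 + y1\<^sup>2) * t2 / 2) * F
        + d * (x2 * t1 - x1 * t2) * M + d * (y2 * t1 - y1 * t2) * N + (t2 - t1) * (d * E)
        - d * t1 * t2 * (r2 * v2 - r1 * v1)"
    using d assms(8,9) unfolding \<gamma> by (simp add: field_simps)
  also have "d * E = (- d * ((x1\<^sup>2 + x2\<^sup>2) / 2 + (y1\<^sup>2 + y2\<^sup>2) / 2) / 2 + (d + 1) * t
             - (s1 * t1 + s2 * t2) / 2) * F
           + d * (x1 + x2) / 2 * M + d * (y1 + y2) / 2 * N
           + t * S
           - d * (r1 * t1 * v1 + r2 * t2 * v2) / 2"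
    using d unfolding E_def \<gamma> t_def by (simp add: field_simps)
  \<comment> \<open>The right side combines the residuals of the three hypotheses. The weight of
    \<open>s2 - s1\<close> is -F t^2: the product \<open>t1 * t2\<close> is completed by (t2 - t1)^2
    / 4, which comes from mean(s) mean(t) - mean(s t) = -(s2 - s1)(t2 - t1) / 4.\<close>
  also have "(- (s2 - s1) * t1 * t2 - d * (x2\<^sup>2 + y2\<^sup>2) * t1 / 2 + d * (x1\<^sup>2 + y1\<^sup>2) * t2 / 2) * F
        + d * (x2 * t1 - x1 * t2) * M + d * (y2 * t1 - y1 * t2) * N + (t2 - t1) * \<dots>
        - d * t1 * t2 * (r2 * v2 - r1 * v1)
      = d * t\<^sup>2 * (F * (m2 - m1) - (r2 - r1) * ((v1 + v2) / 2))
        + t * F * (K * (t2 - t1) - (t1 + t2) / 2 * (l2 - l1))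
        + d * t * (P * (x2 - x1) + Q * (y2 - y1) - (r1 * t1 + r2 * t2) / 2 * (v2 - v1))"
    unfolding s1_def s2_def M_def N_def S_def \<gamma> t_def
    by (simp add: field_simps power2_eq_square)
  also have "\<dots> = 0"
    by (simp add: F K P)
  finally show ?thesis
    using d assms(8,9) by simp
qed

lemma num_flux_entropy_conservative:
  assumes "\<gamma> > 1"
  shows "entropy_conservative \<gamma> j (num_flux \<gamma> j)"
  unfolding entropy_conservative_def
proof (intro ballI)
  fix um up
  assume um: "um \<in> admissible \<gamma>" and up: "up \<in> admissible \<gamma>"
  define F where "F = num_mass j um up"
  define K where "K = mean (RT \<gamma>) um up / log_mean (RT \<gamma>) um up"
  define P where "P k = (if k = j then mean (pressure \<gamma>) um up else 0)" for k
  have F: "F * (ln (density up) - ln (density um)) =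
      (density up - density um) * ((velocity j um + velocity j up) / 2)"
    using log_mean_mult_ln_diff[of density um up] admissible_density_pos[OF um]
      admissible_density_pos[OF up]
    by (simp add: F_def num_mass_def mean_def)
  \<comment> \<open>Writing the difference of \<open>RT\<close> as its log mean times the difference
    of logarithms cancels the denominator of \<open>K\<close>.\<close>
  have K: "K * (RT \<gamma> up - RT \<gamma> um) =
      (RT \<gamma> um + RT \<gamma> up) / 2 * (ln (RT \<gamma> up) - ln (RT \<gamma> um))"
    using log_mean_pos[of "RT \<gamma>" um up] admissible_RT_pos[OF um] admissible_RT_pos[OF up]
    by (simp add: K_def mean_def flip: log_mean_mult_ln_diff)
  have P: "P X * (velocity X up - velocity X um) + P Y * (velocity Y up - velocity Y um) =
      (density um * RT \<gamma> um + density up * RT \<gamma> up) / 2 * (velocity j up - velocity j um)"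
    by (cases j) (simp_all add: P_def mean_def pressure_eq_density_RT um up)
  have "\<gamma> \<noteq> 1" "RT \<gamma> um \<noteq> 0" "RT \<gamma> up \<noteq> 0"
    using assms admissible_RT_pos[OF um] admissible_RT_pos[OF up] by simp_all
  \<comment> \<open>After unfolding, the goal is literally this instance, with \<open>l\<close> and
    \<open>m\<close> read off as the logarithms of \<open>RT\<close> and
    \<open>density\<close>.\<close>
  from entropy_balance[OF this F K P]
  show "(entropy_vars \<gamma> up - entropy_vars \<gamma> um) \<bullet> num_flux \<gamma> j um up
          - (flux_potential j up - flux_potential j um) = 0"
    unfolding num_flux_def inner_vector_4 vector_minus_component
      entropy_vars_RT[OF um] entropy_vars_RT[OF up] vector_4 flux_potential_def speed_sq_def
      num_energy_def num_entropy_def num_momentum_def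
      F_def[symmetric] K_def P_def mean_def entropy_RT_def .
qed

lemma num_flux_kinetic_energy_preserving:
  "kinetic_energy_preserving \<gamma> j (mean (pressure \<gamma>)) (num_flux \<gamma> j)"
  by (cases j) (simp_all add: kinetic_energy_preserving_def num_flux_def num_momentum_def)

theorem mainTheorem10:
  fixes \<gamma> :: real
  assumes "\<gamma> > 1"
  shows "\<forall>j. consistent_flux \<gamma> j (num_flux \<gamma> j)
           \<and> entropy_conservative \<gamma> j (num_flux \<gamma> j)
           \<and> kinetic_energy_preserving \<gamma> j (mean (pressure \<gamma>)) (num_flux \<gamma> j)"
  using num_flux_consistent[OF assms] num_flux_entropy_conservative[OF assms]
    num_flux_kinetic_energy_preserving by blast

end
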